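(* Let $N>1$ and $d\ge 1$ be integers with $d\mid N$, and put $n=N/d$. Let $a$ be the $n\times n$ matrix whose entries are $1$ on the main diagonal and on the superdiagonal (positions $(i,i)$ and $(i,i+1)$) and $0$ elsewhere, and let $b$ be the $n\times n$ matrix whose only nonzero entry is a $1$ in the lower-left corner (position $(n,1)$). (Then the $N\times N$ circulant matrix $C_N=I_N+U_N$, with $U_N$ the cyclic forward shift, is the block circulant matrix with $d\times d$ blocks whose first block row is $(a,b,0,\dots,0)$.) Let $\omega=e^{2\pi i/d}$. Then for every integer $m>0$, $$T(N,0,m)=\left(\frac{1}{d}\sum_{j=0}^{d-1}\left(a+b\,\omega^j\right)^m\right)_{1,1},$$ i.e. $T(N,0,m)$ equals the $(1,1)$ entry of the $n\times n$ matrix $\frac{1}{d}\sum_{j=0}^{d-1}(a+b\omega^j)^m$, where $$T(N,0,m)=\sum_{\substack{0\le j\le m\\ j\equiv 0 \bmod N}}\binom{m}{j}.$$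
   Context: $U_N$ is the $N\times N$ matrix with $(U_N)_{i,i+1}=1$ for $1\le i\le N-1$, $(U_N)_{N,1}=1$, and all other entries $0$; $I_N$ is the identity. When $n=1$, $a=(1)$ and $b=(1)$. The paper writes the conclusion as $T(N,0,m)\doteq \frac1d\sum_{j=0}^{d-1}(a+b\omega^j)^m$, where $x\doteq A$ means $x$ is the $(1,1)$ entry of $A$. *)

theory Defs
  imports Complex_Main "HOL-Number_Theory.Cong" "Jordan_Normal_Form.Matrix"
begin

text \<open>Matrix indices start at 0, so the (1,1) entry of \<open>A\<close> is \<open>A $$ (0, 0)\<close>.\<close>

definition binomial_sum_T :: "nat \<Rightarrow> nat \<Rightarrow> nat \<Rightarrow> nat" where
  "binomial_sum_T N r m = (\<Sum>j | j \<le> m \<and> [j = r] (mod N). m choose j)"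

definition cyclic_shift_mat :: "nat \<Rightarrow> complex mat" where
  "cyclic_shift_mat N = mat N N (\<lambda>(i, j). if j = i + 1 \<or> (i = N - 1 \<and> j = 0) then 1 else 0)"

definition circulant_C :: "nat \<Rightarrow> complex mat" where
  "circulant_C N = 1\<^sub>m N + cyclic_shift_mat N"

definition a_mat :: "nat \<Rightarrow> complex mat" where
  "a_mat n = mat n n (\<lambda>(i, j). if j = i \<or> j = i + 1 then 1 else 0)"

definition b_mat :: "nat \<Rightarrow> complex mat" where
  "b_mat n = mat n n (\<lambda>(i, j). if i = n - 1 \<and> j = 0 then 1 else 0)"

text \<open>Given the first block row \<open>As = [A\<^sub>0, \<dots>, A\<^bsub>d-1\<^esub>]\<close> of \<open>n \<times> n\<close> matrices, the block in
  position \<open>(p, q)\<close> is \<open>A\<^sub>k\<close> with \<open>k = q - p\<close> modulo \<open>d\<close>. The summand \<open>length As\<close> keeps the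
  subtraction on \<open>nat\<close> from truncating.\<close>
definition block_circulant :: "nat \<Rightarrow> 'a mat list \<Rightarrow> 'a mat" where
  "block_circulant n As = mat (length As * n) (length As * n)
     (\<lambda>(r, c). (As ! ((c div n + length As - r div n) mod length As)) $$ (r mod n, c mod n))"

text \<open>The block row \<open>(a, b, 0, \<dots>, 0)\<close> of length \<open>d\<close>. For \<open>d = 1\<close> the positions of \<open>a\<close> and
  \<open>b\<close> coincide modulo \<open>d\<close>, and the only block is \<open>a + b\<close>.\<close>
definition first_block_row :: "nat \<Rightarrow> nat \<Rightarrow> complex mat list" where
  "first_block_row d n =
     (if d = 1 then [a_mat n + b_mat n]
      else a_mat n # b_mat n # replicate (d - 2) (0\<^sub>m n n))"

text \<open>The analogue for matrices of \<^const>\<open>finsum_vec\<close>: dimensions are not part of the type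
  \<^typ>\<open>'a mat\<close>, so \<^const>\<open>sum\<close> is not available.\<close>
definition finsum_mat ::
  "'a :: monoid_add itself \<Rightarrow> nat \<Rightarrow> nat \<Rightarrow> ('c \<Rightarrow> 'a mat) \<Rightarrow> 'c set \<Rightarrow> 'a mat" where
  "finsum_mat ty nr nc = finprod (monoid_mat ty nr nc)"

lemma finsum_mat_carrier_and_index:
  fixes A :: "'c \<Rightarrow> 'a :: comm_monoid_add mat"
  assumes "finite F" and "A \<in> F \<rightarrow> carrier_mat nr nc"
  shows "finsum_mat TYPE('a) nr nc A F \<in> carrier_mat nr nc \<and>
    (\<forall>i<nr. \<forall>j<nc. finsum_mat TYPE('a) nr nc A F $$ (i, j) = (\<Sum>f\<in>F. A f $$ (i, j)))"
  using assms
proof (induction F rule: finite_induct)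
  case empty
  have "finsum_mat TYPE('a) nr nc A {} = 0\<^sub>m nr nc"
    using comm_monoid.finprod_empty[OF comm_monoid_mat, where f = A]
    by (simp add: finsum_mat_def monoid_mat_def)
  then show ?case by simp
next
  case (insert f F)
  have "finsum_mat TYPE('a) nr nc A (insert f F) = A f + finsum_mat TYPE('a) nr nc A F"
    using comm_monoid.finprod_insert[OF comm_monoid_mat insert.hyps, where f = A] insert.prems
    by (simp add: finsum_mat_def monoid_mat_def Pi_def)
  with insert show ?case by auto
qed

end

theory Submission
  imports Defs "HOL-Analysis.Complex_Transcendental"
begin

text \<open>
  The matrix \<open>a + z b\<close> is the identity plus a cyclic shift weighted by \<open>z\<close> at the wrap-around, so
  the first row of its \<open>m\<close>-th power collects the terms \<open>(m choose k) z ^ (k div n)\<close> in column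
  \<open>k mod n\<close>. Averaging the entry in column 0 over \<open>z = \<omega> ^ j\<close> keeps exactly those \<open>k\<close> with
  \<open>n dvd k\<close> and \<open>d dvd k div n\<close>, that is, the multiples of \<open>N\<close>.
\<close>

lemma mult_add_eq_mult_add_iff:
  fixes n p q s t :: nat
  assumes "s < n" and "t < n"
  shows "q * n + t = p * n + s \<longleftrightarrow> q = p \<and> t = s"
proof
  assume eq: "q * n + t = p * n + s"
  have "(q * n + t) div n = q" "(q * n + t) mod n = t"
       "(p * n + s) div n = p" "(p * n + s) mod n = s"
    using assms by auto
  with eq show "q = p \<and> t = s" by simp
qed simp

text \<open>Adding one to an index either stays inside its block or carries to the start of the next
  one. The first case gives the superdiagonal ones of \<open>a_mat\<close>, the second the corner
  one of \<open>b_mat\<close>.\<close>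

lemma mult_add_eq_Suc_mult_add_iff:
  fixes n p q s t :: nat
  assumes "s < n" and "t < n"
  shows "q * n + t = Suc (p * n + s) \<longleftrightarrow> q = p \<and> t = Suc s \<or> q = Suc p \<and> t = 0 \<and> s = n - 1"
proof (cases "Suc s = n")
  case True
  then have "Suc (p * n + s) = Suc p * n + 0" by simp
  then have "q * n + t = Suc (p * n + s) \<longleftrightarrow> q = Suc p \<and> t = 0"
    using mult_add_eq_mult_add_iff[of 0 n t q "Suc p"] assms by (simp only:)
  with True assms show ?thesis by auto
next
  case False
  with assms have "Suc s < n" by simp
  then have "q * n + t = Suc (p * n + s) \<longleftrightarrow> q = p \<and> t = Suc s"
    using mult_add_eq_mult_add_iff[of "Suc s" n t q p] assms by simp
  with False assms show ?thesis by auto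
qed

lemma first_block_row_nth:
  assumes "1 < d" and "k < d"
  shows "first_block_row d n ! k =
    (if k = 0 then a_mat n else if k = 1 then b_mat n else 0\<^sub>m n n)"
  using assms by (auto simp: first_block_row_def nth_Cons split: nat.split)

lemma cyclic_distance_eq_0_iff:
  fixes d p q :: nat
  assumes "p < d" and "q < d"
  shows "(q + d - p) mod d = 0 \<longleftrightarrow> q = p"
  using assms by (cases "p \<le> q") (auto simp: le_mod_geq not_le)

text \<open>Going one step forward around a cycle of length \<open>d\<close> means taking the
  successor or wrapping from \<open>d - 1\<close> to 0. With \<open>d = 1\<close> the residue 1
  never occurs, hence \<open>1 < d\<close>.\<close>

lemma cyclic_distance_eq_1_iff:
  fixes d p q :: nat
  assumes "1 < d" and "p < d" and "q < d"
  shows "(q + d - p) mod d = 1 \<longleftrightarrow> q = Suc p \<or> p = d - 1 \<and> q = 0"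
  using assms by (cases "p \<le> q") (auto simp: le_mod_geq not_le)

lemma circulant_C_eq_block_circulant:
  assumes "0 < n" and "0 < d" and "1 < d * n"
  shows "circulant_C (d * n) = block_circulant n (first_block_row d n)"
proof (rule eq_matI)
  have len: "length (first_block_row d n) = d"
    using assms by (auto simp: first_block_row_def)
  show "dim_row (circulant_C (d * n)) = dim_row (block_circulant n (first_block_row d n))"
    and "dim_col (circulant_C (d * n)) = dim_col (block_circulant n (first_block_row d n))"
    by (auto simp: circulant_C_def block_circulant_def cyclic_shift_mat_def len)
  fix r c
  assume "r < dim_row (block_circulant n (first_block_row d n))"
    and "c < dim_col (block_circulant n (first_block_row d n))"
  then have r: "r < d * n" and c: "c < d * n" by (auto simp: block_circulant_def len)
  \<comment> \<open>The entry is never 2: since \<open>1 < d * n\<close>, the wrap-around one of the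
    shift lies off the diagonal.\<close>
  have C: "circulant_C (d * n) $$ (r, c) =
      (if c = r \<or> c = Suc r \<or> Suc r = d * n \<and> c = 0 then 1 else 0)"
    using r c assms by (auto simp: circulant_C_def cyclic_shift_mat_def)
  show "circulant_C (d * n) $$ (r, c) = block_circulant n (first_block_row d n) $$ (r, c)"
  proof (cases "d = 1")
    case True
    then show ?thesis using r c assms
      by (subst C) (auto simp: block_circulant_def first_block_row_def a_mat_def b_mat_def)
  next
    case False
    define p q s t where "p = r div n" and "q = c div n" and "s = r mod n" and "t = c mod n"
    have rc: "r = p * n + s" "c = q * n + t" by (simp_all add: p_def q_def s_def t_def)
    have d: "1 < d" using False assms by simp
    have b: "p < d" "q < d" "s < n" "t < n"
      using r c assms by (auto simp: p_def q_def s_def t_def less_mult_imp_div_less)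
    define k where "k = (q + d - p) mod d"
    have "k < d" using d by (simp add: k_def)
    \<comment> \<open>The last row is the last row of the last block, so the wrap-around condition
      can be read off from \<open>p\<close> and \<open>s\<close>.\<close>
    have "d * n = Suc ((d - 1) * n + (n - 1))"
      using assms by (cases d; cases n) auto
    then have "Suc r = d * n \<longleftrightarrow> p * n + s = (d - 1) * n + (n - 1)"
      by (simp add: rc)
    then have last: "Suc r = d * n \<longleftrightarrow> p = d - 1 \<and> s = n - 1"
      using mult_add_eq_mult_add_iff[of "n - 1" n s p "d - 1"] b by simp
    have c0: "c = 0 \<longleftrightarrow> q = 0 \<and> t = 0" using assms by (simp add: rc)
    have k0: "k = 0 \<longleftrightarrow> q = p" and k1: "k = 1 \<longleftrightarrow> q = Suc p \<or> p = d - 1 \<and> q = 0"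
      unfolding k_def using cyclic_distance_eq_0_iff cyclic_distance_eq_1_iff b d by auto
    have "block_circulant n (first_block_row d n) $$ (r, c) = first_block_row d n ! k $$ (s, t)"
      using r c by (simp add: block_circulant_def len k_def p_def q_def s_def t_def)
    also have "\<dots> = (if k = 0 then a_mat n else if k = 1 then b_mat n else 0\<^sub>m n n) $$ (s, t)"
      by (simp add: first_block_row_nth[OF d \<open>k < d\<close>])
    \<comment> \<open>The cases \<open>k = 0\<close> and \<open>k = 1\<close> merge into one
      indicator, since for \<open>1 < d\<close> a block is never its own cyclic successor.\<close>
    also have "\<dots> = (if q = p \<and> (t = s \<or> t = Suc s)
        \<or> (q = Suc p \<or> p = d - 1 \<and> q = 0) \<and> s = n - 1 \<and> t = 0 then 1 else 0)"
      unfolding k0 k1 using b d by (auto simp: a_mat_def b_mat_def)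
    also have "\<dots> = circulant_C (d * n) $$ (r, c)"
      unfolding C last c0 using mult_add_eq_mult_add_iff[OF b(3,4), of q p]
        mult_add_eq_Suc_mult_add_iff[OF b(3,4), of q p]
      unfolding rc[symmetric] by auto
    finally show ?thesis by simp
  qed
qed

text \<open>Pascal's rule summed against a weight: each \<open>m choose k\<close> contributes once
  at \<open>k\<close> and once at \<open>Suc k\<close>.\<close>

lemma sum_choose_Suc_mult:
  fixes f :: "nat \<Rightarrow> 'a :: comm_semiring_1"
  shows "(\<Sum>k\<le>Suc m. of_nat (Suc m choose k) * f k)
    = (\<Sum>k\<le>m. of_nat (m choose k) * (f k + f (Suc k)))"
proof -
  have "(\<Sum>k\<le>Suc m. of_nat (Suc m choose k) * f k)
      = f 0 + (\<Sum>k\<le>m. of_nat (m choose Suc k) * f (Suc k))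
        + (\<Sum>k\<le>m. of_nat (m choose k) * f (Suc k))"
    by (subst sum.atMost_Suc_shift) (simp add: algebra_simps sum.distrib)
  also have "f 0 + (\<Sum>k\<le>m. of_nat (m choose Suc k) * f (Suc k))
      = (\<Sum>k\<le>Suc m. of_nat (m choose k) * f k)"
    by (subst sum.atMost_Suc_shift) simp
  also have "\<dots> = (\<Sum>k\<le>m. of_nat (m choose k) * f k)"
    by (simp add: binomial_eq_0)
  finally show ?thesis by (simp add: distrib_left sum.distrib)
qed

text \<open>Induction on \<open>m\<close>: a further factor keeps each term in its column or moves
  it to the next one, with a factor \<open>z\<close> when it passes from column \<open>n - 1\<close>
  to column 0. This is the passage from \<open>k\<close> to \<open>Suc k\<close>, so Pascal's rule
  closes the step.\<close>

lemma pow_mat_first_row: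
  fixes z :: complex
  assumes "j < n"
  shows "((a_mat n + z \<cdot>\<^sub>m b_mat n) ^\<^sub>m m) $$ (0, j)
    = (\<Sum>k\<le>m. of_nat (m choose k) * (if k mod n = j then z ^ (k div n) else 0))"
  using assms
proof (induction m arbitrary: j)
  case 0
  then show ?case by (auto simp: a_mat_def b_mat_def)
next
  case (Suc m)
  let ?M = "a_mat n + z \<cdot>\<^sub>m b_mat n"
  define f where "f j k = (if k mod n = j then z ^ (k div n) else 0)" for j k
  have M: "?M \<in> carrier_mat n n" by (simp add: a_mat_def b_mat_def)
  then have P: "?M ^\<^sub>m m \<in> carrier_mat n n" by simp
  have IH: "(?M ^\<^sub>m m) $$ (0, i) = (\<Sum>k\<le>m. of_nat (m choose k) * f i k)" if "i < n" for i
    using Suc.IH[OF that] by (simp add: f_def)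
  \<comment> \<open>Each summand selects a single \<open>i\<close>, so the sum over \<open>i\<close>
    collapses. The summands are added because for \<open>n = 1\<close> diagonal and corner coincide,
    giving \<open>1 + z\<close>; the test \<open>j = 0\<close> guards against the truncated
    \<open>j - 1\<close>.\<close>
  have entry: "?M $$ (i, j) = (if i = j then 1 else 0) + (if i = j - 1 then if j = 0 then 0 else 1 else 0)
      + (if i = n - 1 then if j = 0 then z else 0 else 0)" if "i < n" for i
    using that Suc.prems by (auto simp: a_mat_def b_mat_def)
  have step: "f j (Suc k) = (if j = 0 then z * f (n - 1) k else f (j - 1) k)" for k
    using Suc.prems by (auto simp: f_def mod_Suc div_Suc)
  have "(?M ^\<^sub>m Suc m) $$ (0, j) = (\<Sum>i<n. (?M ^\<^sub>m m) $$ (0, i) * ?M $$ (i, j))"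
    using Suc.prems carrier_matD[OF M] carrier_matD[OF P]
    by (simp add: scalar_prod_def atLeast0LessThan del: index_add_mat index_smult_mat)
  also have "\<dots> = (?M ^\<^sub>m m) $$ (0, j) +
      (if j = 0 then z * (?M ^\<^sub>m m) $$ (0, n - 1) else (?M ^\<^sub>m m) $$ (0, j - 1))"
    using Suc.prems
    by (simp add: entry distrib_left sum.distrib if_distrib[where f = "\<lambda>x. _ * x"] cong: if_cong)
  also have "\<dots> = (\<Sum>k\<le>m. of_nat (m choose k) * (f j k + f j (Suc k)))"
    using Suc.prems
    by (auto simp: IH step distrib_left sum.distrib sum_distrib_left ac_simps)
  also have "\<dots> = (\<Sum>k\<le>Suc m. of_nat (Suc m choose k) * f j k)"
    by (rule sum_choose_Suc_mult[symmetric])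
  finally show ?case by (simp only: f_def)
qed

text \<open>Exchanging the exponents gives a geometric sum with ratio \<open>\<omega> ^ q\<close>, a
  \<open>d\<close>-th root of unity that equals 1 exactly when \<open>d dvd q\<close>. For any other
  ratio the numerator of the closed form vanishes.\<close>

lemma sum_root_unity_powers:
  fixes \<omega> :: complex
  assumes "0 < d" and \<omega>: "\<omega> = exp (2 * of_real pi * \<i> / of_nat d)"
  shows "(\<Sum>j<d. (\<omega> ^ j) ^ q) = (if d dvd q then of_nat d else 0)"
proof -
  have pow: "\<omega> ^ q = exp (2 * of_real pi * \<i> * of_nat q / of_nat d)"
    by (simp add: \<omega> exp_of_nat_mult[symmetric] mult_ac)
  have one: "\<omega> ^ q = 1 \<longleftrightarrow> d dvd q"
    unfolding pow using assms(1) by (subst complex_root_unity_eq_1) auto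
  have "\<omega> ^ d = 1" using assms(1) by (simp add: \<omega> exp_of_nat_mult[symmetric])
  then have "(\<omega> ^ q) ^ d = 1" by (metis power_mult mult.commute power_one)
  have swap: "(\<Sum>j<d. (\<omega> ^ j) ^ q) = (\<Sum>j<d. (\<omega> ^ q) ^ j)"
    by (metis power_mult mult.commute)
  show ?thesis
  proof (cases "d dvd q")
    case True
    with one swap show ?thesis by simp
  next
    case False
    with one \<open>(\<omega> ^ q) ^ d = 1\<close> swap show ?thesis by (simp add: sum_gp_strict)
  qed
qed

theorem theorem2:
  fixes N d n m :: nat and \<omega> :: complex
  assumes "N > 1" and "d \<ge> 1" and "d dvd N"
    and "n = N div d"
    and "\<omega> = exp (2 * of_real pi * \<i> / of_nat d)"
    and "m > 0"
  shows "circulant_C N = block_circulant n (first_block_row d n)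
    \<and> of_nat (binomial_sum_T N 0 m)
        = ((1 / of_nat d) \<cdot>\<^sub>m finsum_mat TYPE(complex) n n
              (\<lambda>j. (a_mat n + \<omega> ^ j \<cdot>\<^sub>m b_mat n) ^\<^sub>m m) {..<d}) $$ (0, 0)"
proof
  have N: "N = d * n" and n: "0 < n" and d: "0 < d"
    using assms by (auto elim!: dvdE intro: Nat.gr0I)
  show "circulant_C N = block_circulant n (first_block_row d n)"
    using circulant_C_eq_block_circulant[OF n d] assms(1) N by simp
  let ?A = "\<lambda>j. (a_mat n + \<omega> ^ j \<cdot>\<^sub>m b_mat n) ^\<^sub>m m"
  let ?S = "finsum_mat TYPE(complex) n n ?A {..<d}"
  have "a_mat n + \<omega> ^ j \<cdot>\<^sub>m b_mat n \<in> carrier_mat n n" for j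
    by (simp add: a_mat_def b_mat_def)
  then have "?A \<in> {..<d} \<rightarrow> carrier_mat n n" by simp
  from finsum_mat_carrier_and_index[OF finite_lessThan this] n
  have S: "?S \<in> carrier_mat n n" and S00: "?S $$ (0, 0) = (\<Sum>j<d. ?A j $$ (0, 0))"
    by auto
  have dvd: "k mod n = 0 \<and> d dvd k div n \<longleftrightarrow> N dvd k" for k
  proof -
    \<comment> \<open>Divisibility by \<open>N = d * n\<close> entails divisibility by
      \<open>n\<close>; writing \<open>k\<close> as a multiple of \<open>n\<close> then lets
      \<open>n\<close> cancel, leaving \<open>d dvd k div n\<close>.\<close>
    have "N dvd k \<longleftrightarrow> n dvd k \<and> N dvd k" using N dvd_mult_right by blast
    also have "\<dots> \<longleftrightarrow> n dvd k \<and> d dvd k div n"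
      using n N by (auto elim!: dvdE simp: ac_simps)
    finally show ?thesis by (simp add: dvd_eq_mod_eq_0[symmetric])
  qed
  have "?S $$ (0, 0) = (\<Sum>j<d. \<Sum>k\<le>m. of_nat (m choose k) *
      (if k mod n = 0 then (\<omega> ^ j) ^ (k div n) else 0))"
    by (simp add: S00 pow_mat_first_row[OF n])
  also have "\<dots> = (\<Sum>k\<le>m. of_nat (m choose k) *
      (if k mod n = 0 then \<Sum>j<d. (\<omega> ^ j) ^ (k div n) else 0))"
    by (subst sum.swap) (auto simp: sum_distrib_left intro!: sum.cong)
  \<comment> \<open>The inner sum over the roots of unity is \<open>d\<close> or 0; this
    \<open>d\<close> is what the prefactor \<open>1 / of_nat d\<close> cancels.\<close>
  also have "\<dots> = (\<Sum>k\<le>m. if N dvd k then of_nat (m choose k) * of_nat d else 0)"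
    by (auto simp: sum_root_unity_powers[OF d assms(5)] simp flip: dvd intro!: sum.cong)
  also have "\<dots> = of_nat d * of_nat (binomial_sum_T N 0 m)"
    by (simp add: binomial_sum_T_def cong_0_iff sum.If_cases sum_distrib_left mult.commute
        Collect_conj_eq atMost_def)
  finally show "of_nat (binomial_sum_T N 0 m) = ((1 / of_nat d) \<cdot>\<^sub>m ?S) $$ (0, 0)"
    using S n d by simp
qed

end
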